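(* For every constant $c<1$ there exists an integer $n_c$ such that for all $n>n_c$, at least $c^n n!$ patterns $\pi$ of length $n$ satisfy a nontrivial c-forest-Wilf equivalence, i.e. there is a pattern $\pi'$ of length $n$ with $\pi'\ne\pi$ and $\pi'\ne\overline\pi$ that is c-forest-Wilf equivalent to $\pi$.
   Context: A rooted labeled forest on $[n]$ is an unordered forest on $n$ vertices, each component with a distinguished root, with distinct vertex labels from $[n]$. A pattern of length $k$ is a permutation of $[k]$; its complement is $\overline\pi=(k+1-\pi(1))\cdots(k+1-\pi(k))$. A consecutive instance of $\pi$ in a forest is a downward path $v_1,\dots,v_k$ ($v_i$ the parent of $v_{i+1}$) whose labels are in the same relative order as $\pi$. Two patterns are c-forest-Wilf equivalent if for every $n\ge0$ the numbers of rooted labeled forests on $[n]$ with no consecutive instance of each of them are equal. *)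

theory Defs
  imports Complex_Main
begin

text \<open>A rooted labeled forest on [n] = {1..n} is encoded by its parent map
  par :: nat => nat option: par v = None means v is a root (or v is not a vertex),
  par v = Some p means p is the parent of v. The child-of relation must be acyclic.
  This encoding is a bijection with rooted labeled forests on [n].\<close>

definition parent_rel :: "(nat \<Rightarrow> nat option) \<Rightarrow> (nat \<times> nat) set" where
  "parent_rel par = {(p, v). par v = Some p}"

definition forests :: "nat \<Rightarrow> (nat \<Rightarrow> nat option) set" where
  "forests n = {par. (\<forall>v. v \<notin> {1..n} \<longrightarrow> par v = None)
                   \<and> (\<forall>v p. par v = Some p \<longrightarrow> p \<in> {1..n})
                   \<and> acyclic (parent_rel par)}"

definition patterns :: "nat \<Rightarrow> nat list set" where
  "patterns k = {\<pi>. length \<pi> = k \<and> distinct \<pi> \<and> set \<pi> = {1..k}}"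

definition complement :: "nat list \<Rightarrow> nat list" where
  "complement \<pi> = map (\<lambda>x. length \<pi> + 1 - x) \<pi>"

definition consec_instance :: "(nat \<Rightarrow> nat option) \<Rightarrow> nat list \<Rightarrow> nat list \<Rightarrow> bool" where
  "consec_instance par \<pi> vs \<longleftrightarrow>
     length vs = length \<pi> \<and> vs \<noteq> [] \<and>
     (\<forall>i < length vs - 1. par (vs ! (i+1)) = Some (vs ! i)) \<and>
     (\<forall>i < length vs. \<forall>j < length vs. (vs ! i < vs ! j \<longleftrightarrow> \<pi> ! i < \<pi> ! j))"

definition contains_pattern :: "nat \<Rightarrow> (nat \<Rightarrow> nat option) \<Rightarrow> nat list \<Rightarrow> bool" where
  "contains_pattern n par \<pi> \<longleftrightarrow> (\<exists>vs. set vs \<subseteq> {1..n} \<and> consec_instance par \<pi> vs)"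

definition avoid_count :: "nat \<Rightarrow> nat list \<Rightarrow> nat" where
  "avoid_count n \<pi> = card {par \<in> forests n. \<not> contains_pattern n par \<pi>}"

definition c_forest_wilf_equiv :: "nat list \<Rightarrow> nat list \<Rightarrow> bool" where
  "c_forest_wilf_equiv \<pi> \<sigma> \<longleftrightarrow> (\<forall>n. avoid_count n \<pi> = avoid_count n \<sigma>)"

end

theory Submission
  imports Defs "HOL-Combinatorics.Multiset_Permutations"
begin

text \<open>
  Removing the entries 1 to 9 from a pattern of length n that starts with 1, 4, 7 and ends with
  2, 8, 5, 3, 9, 6 leaves an arbitrary word on the remaining values, so there are (n - 9)! such
  patterns, which beats c^n n!. Each of them is equivalent to the pattern in which the values
  5 and 6 are exchanged.

  By inclusion-exclusion it suffices to find a bijection between forests with a set of marked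
  instances of the two patterns that preserves the number of marks. The shape of the patterns forces
  instances that overlap in a vertex playing the role of 5 or 6 either to agree from their roots down
  to that vertex, or to have this vertex as the root of one of them and share nothing else. The
  vertices in the role of 6 that hang below a given vertex a in the role of 5 all have labels between
  those in the roles of 4 and 7, which lie above a. Hence a can trade places with the largest of them:
  marked instances through a follow the roles, everything else stays attached to its label. The
  inverse uses the smallest label instead.
\<close>

section \<open>The two patterns and the exchange of marked vertices\<close>

definition swap_pattern :: "bool \<Rightarrow> nat list \<Rightarrow> nat list" where
  "swap_pattern up \<sigma> =
     [1, 4, 7] @ \<sigma> @ (if up then [2, 8, 5, 3, 9, 6] else [2, 8, 6, 3, 9, 5])"

definition occurrences :: "nat \<Rightarrow> (nat \<Rightarrow> nat option) \<Rightarrow> nat list \<Rightarrow> nat list set" where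
  "occurrences n par \<pi> = {vs. set vs \<subseteq> {1..n} \<and> consec_instance par \<pi> vs}"

text \<open>When \<open>up\<close> holds all bottoms exceed their top, otherwise all are smaller.
  The label farthest from the top is chosen, so every other bottom lies between the old top and the
  new one.\<close>

definition pick :: "bool \<Rightarrow> nat set \<Rightarrow> nat" where
  "pick up X = (if up then Max X else Min X)"

definition bottoms :: "nat \<Rightarrow> nat list set \<Rightarrow> nat \<Rightarrow> nat set" where
  "bottoms m S a = {v ! (m + 8) | v. v \<in> S \<and> v ! (m + 5) = a}"

text \<open>A relation rather than a function, so that inverting the exchange amounts to taking the
  converse.\<close>

definition swap_rel :: "nat \<Rightarrow> bool \<Rightarrow> nat list set \<Rightarrow> (nat \<times> nat) set" where
  "swap_rel m up S = {(v ! (m + 5), pick up (bottoms m S (v ! (m + 5)))) | v. v \<in> S}"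

text \<open>For marked paths in a forest distinct pairs share no vertex
  (\<open>mate_neq_top\<close>, \<open>mate_inj\<close>), so the symmetric closure is single-valued
  and the map is an involution.\<close>

definition swap_map :: "nat \<Rightarrow> bool \<Rightarrow> nat list set \<Rightarrow> nat \<Rightarrow> nat" where
  "swap_map m up S w =
     (if w \<in> Domain (swap_rel m up S \<union> (swap_rel m up S)\<inverse>)
      then THE b. (w, b) \<in> swap_rel m up S \<union> (swap_rel m up S)\<inverse> else w)"

text \<open>The entry at index 0 keeps its label even if \<open>swap_map\<close> moves it: the first
  vertex of a marked path may be a top or a bottom of another one.\<close>

definition swap_path :: "nat \<Rightarrow> bool \<Rightarrow> nat list set \<Rightarrow> nat list \<Rightarrow> nat list" where
  "swap_path m up S v =
     v[m + 5 := swap_map m up S (v ! (m + 5)), m + 8 := swap_map m up S (v ! (m + 8))]"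

text \<open>
  The vertices at index m + 6 are the children of a swapped vertex on a marked path, so they follow
  its role; the other children follow its label.
\<close>

definition swap_par ::
  "nat \<Rightarrow> bool \<Rightarrow> nat list set \<Rightarrow> (nat \<Rightarrow> nat option) \<Rightarrow> nat \<Rightarrow> nat option" where
  "swap_par m up S par w =
     (if w \<in> (\<lambda>v. v ! (m + 6)) ` S then map_option (swap_map m up S) (par w)
      else par (swap_map m up S w))"

section \<open>Entries and self-overlaps of the patterns\<close>

lemma length_swap_pattern [simp]: "length (swap_pattern up \<sigma>) = length \<sigma> + 9"
  by (simp add: swap_pattern_def)

lemma swap_pattern_nth:
  fixes \<sigma> :: "nat list"
  defines "m \<equiv> length \<sigma>"
  shows "swap_pattern up \<sigma> ! 0 = 1" "swap_pattern up \<sigma> ! Suc 0 = 4" "swap_pattern up \<sigma> ! 2 = 7"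
    "swap_pattern up \<sigma> ! (m + 3) = 2" "swap_pattern up \<sigma> ! (m + 4) = 8"
    "swap_pattern up \<sigma> ! (m + 5) = (if up then 5 else 6)" "swap_pattern up \<sigma> ! (m + 6) = 3"
    "swap_pattern up \<sigma> ! (m + 7) = 9" "swap_pattern up \<sigma> ! (m + 8) = (if up then 6 else 5)"
    "3 \<le> i \<Longrightarrow> i < m + 3 \<Longrightarrow> swap_pattern up \<sigma> ! i = \<sigma> ! (i - 3)"
  by (auto simp: swap_pattern_def m_def nth_append nth_Cons' numeral_eq_Suc)

lemma index_cases:
  fixes i m :: nat
  assumes "i < m + 9"
  obtains "i = 0" | "i = 1" | "i = 2" | "3 \<le> i" "i < m + 3" | "i = m + 3" | "i = m + 4"
    | "i = m + 5" | "i = m + 6" | "i = m + 7" | "i = m + 8"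
  using assms by linarith

lemma pick_in: "finite X \<Longrightarrow> X \<noteq> {} \<Longrightarrow> pick up X \<in> X"
  by (simp add: pick_def)

lemma less_pick_iff:
  assumes "finite X" "b \<in> X" "b \<noteq> pick up X"
  shows "b < pick up X \<longleftrightarrow> up"
  using assms by (auto simp: pick_def order.strict_iff_order dest: Max_ge Min_le)

lemma swap_pattern_not_small:
  assumes "set \<sigma> \<subseteq> {10..}" "1 \<le> i" "i < length \<sigma> + 9" "i \<noteq> length \<sigma> + 3"
  shows "2 < swap_pattern up \<sigma> ! i"
proof -
  have "10 \<le> \<sigma> ! (i - 3)" if "3 \<le> i" "i < length \<sigma> + 3"
    using assms(1) that nth_mem[of "i - 3" \<sigma>] by force
  with assms show ?thesis
    by - (rule index_cases[of i "length \<sigma>"]; simp add: swap_pattern_nth)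
qed

text \<open>
  The prefix of length i + 1 is compared with the factor at index s. The smallest entry of the
  prefix is its first one, whereas a factor reaching the last entries usually contains 2.
\<close>

lemma swap_pattern_no_overlap:
  fixes \<sigma> :: "nat list" and up :: bool
  defines "m \<equiv> length \<sigma>" and "\<pi> \<equiv> swap_pattern up \<sigma>"
  assumes \<sigma>: "set \<sigma> \<subseteq> {10..}" "\<sigma> \<noteq> []"
    and si: "1 \<le> s" "1 \<le> i" "s + i < m + 9"
    and iso: "\<And>t t'. t \<le> i \<Longrightarrow> t' \<le> i \<Longrightarrow> \<pi> ! t < \<pi> ! t' \<longleftrightarrow> \<pi> ! (s + t) < \<pi> ! (s + t')"
  shows "i \<notin> {m + 5, m + 6, m + 8} \<and> s + i \<notin> {m + 5, m + 6, m + 8}"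
proof (rule ccontr)
  assume "\<not> ?thesis"
  then have j: "s + i \<in> {m + 5..m + 8}" "s + i \<noteq> m + 7 \<or> m + 5 \<le> i"
    using si by auto
  have m: "1 \<le> m" using \<sigma>(2) by (cases \<sigma>) (auto simp: m_def)
  note nth = swap_pattern_nth[where \<sigma> = \<sigma> and up = up, folded m_def \<pi>_def]
  consider "s < m + 3" | "s = m + 3" | "s = m + 4" | "s = m + 5" | "s = m + 6" | "s = m + 7"
    using si j by fastforce
  then show False
  proof cases
    case 1
    \<comment> \<open>Index \<open>t\<close> of the prefix faces the entry 2 of the factor, which
      would force the first entry of the factor below 2.\<close>
    define t where "t = m + 3 - s"
    have t: "1 \<le> t" "t \<le> i" "s + t = m + 3" using 1 j by (auto simp: t_def)
    have "\<pi> ! 0 < \<pi> ! t"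
    proof (cases "t = m + 3")
      case True then show ?thesis by (simp add: nth)
    next
      case False
      then show ?thesis
        using swap_pattern_not_small[OF \<sigma>(1), of t up] t si
        by (simp add: nth m_def[symmetric] \<pi>_def[symmetric])
    qed
    then have "\<pi> ! s < 2" using iso[of 0 t] t by (simp add: nth)
    moreover have "2 < \<pi> ! s"
      using swap_pattern_not_small[OF \<sigma>(1), of s up] 1 si by (simp add: m_def \<pi>_def)
    ultimately show False by simp
  next
    \<comment> \<open>From here on the prefix \<open>1, 4, 7\<close> ascends where the factor
      descends: \<open>8, 5\<close>, \<open>5, 3\<close> or \<open>9, 6\<close>, with 5 and 6
      exchanged if \<open>up\<close> is false.\<close>
    case 2
    then have "2 \<le> i" using j by auto
    then show False using iso[of 1 2] 2 nth by (simp add: add.commute split: if_splits)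
  next
    case 3
    then show False using iso[of 0 1] si nth by (simp add: add.commute split: if_splits)
  next
    case 4
    then show False using iso[of 0 1] si nth by (simp add: add.commute split: if_splits)
  next
    case 5
    \<comment> \<open>The case \<open>i = 1\<close> has to be excluded: the factor
      \<open>3, 9\<close> is order isomorphic to the prefix \<open>1, 4\<close>. This is why
      \<open>m + 7\<close> is missing among the critical indices.\<close>
    then have "i = 2" using j si m by auto
    then show False using iso[of 1 2] 5 nth by (simp add: add.commute split: if_splits)
  next
    case 6
    then show False using iso[of 0 1] si nth by (simp add: add.commute split: if_splits)
  qed
qed

section \<open>Marked forests and how marked paths overlap\<close>

lemma forestsD:
  assumes "par \<in> forests n"
  shows "w \<notin> {1..n} \<Longrightarrow> par w = None" "par w = Some p \<Longrightarrow> p \<in> {1..n}"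
    "acyclic (parent_rel par)"
proof -
  have "(\<forall>v. v \<notin> {1..n} \<longrightarrow> par v = None) \<and> (\<forall>v p. par v = Some p \<longrightarrow> p \<in> {1..n}) \<and>
      acyclic (parent_rel par)"
    using assms unfolding forests_def by (rule CollectD)
  then show "w \<notin> {1..n} \<Longrightarrow> par w = None" "par w = Some p \<Longrightarrow> p \<in> {1..n}" "acyclic (parent_rel par)"
    by blast+
qed

text \<open>A single term of the inclusion-exclusion sum. Keeping \<open>up\<close> general lets the
  exchange and its inverse share every lemma.\<close>

locale marked_forest =
  fixes n :: nat and up :: bool and \<sigma> :: "nat list" and par :: "nat \<Rightarrow> nat option"
    and S :: "nat list set"
  assumes big: "set \<sigma> \<subseteq> {10..}" "\<sigma> \<noteq> []"
    and forest: "par \<in> forests n"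
    and marked: "S \<subseteq> occurrences n par (swap_pattern up \<sigma>)"
begin

abbreviation "m \<equiv> length \<sigma>"
abbreviation "\<pi> \<equiv> swap_pattern up \<sigma>"
abbreviation "\<theta> \<equiv> swap_map m up S"
abbreviation "top_vertex v \<equiv> v ! (m + 5)"
abbreviation "bot_vertex v \<equiv> v ! (m + 8)"
abbreviation "mate a \<equiv> pick up (bottoms m S a)"
abbreviation "path' \<equiv> swap_path m up S"
abbreviation "par' \<equiv> swap_par m up S par"

lemma marked_path:
  assumes "v \<in> S"
  shows "length v = m + 9" "set v \<subseteq> {1..n}"
    "\<And>i. Suc i < m + 9 \<Longrightarrow> par (v ! Suc i) = Some (v ! i)"
    "\<And>i j. i < m + 9 \<Longrightarrow> j < m + 9 \<Longrightarrow> v ! i < v ! j \<longleftrightarrow> \<pi> ! i < \<pi> ! j"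
  using assms marked by (auto simp: occurrences_def consec_instance_def)

lemma marked_edge: "v \<in> S \<Longrightarrow> j = Suc i \<Longrightarrow> j < m + 9 \<Longrightarrow> par (v ! j) = Some (v ! i)"
  using marked_path(3) by simp

lemma nth_in_range: "v \<in> S \<Longrightarrow> i < m + 9 \<Longrightarrow> v ! i \<in> {1..n}"
  using marked_path(1,2) nth_mem by (metis subsetD)

text \<open>Parents are unique, so two marked paths that meet coincide upwards until one of them
  ends.\<close>

lemma paths_agree_above:
  assumes "v \<in> S" "w \<in> S" "v ! i = w ! (s + i)" "s + i < m + 9" "t \<le> i"
  shows "v ! t = w ! (s + t)"
  using assms(3-5)
proof (induction i)
  case (Suc i)
  have "par (v ! Suc i) = Some (v ! i)" "par (w ! Suc (s + i)) = Some (w ! (s + i))"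
    using Suc.prems marked_path(3)[OF assms(1), of i] marked_path(3)[OF assms(2), of "s + i"]
    by simp_all
  with Suc show ?case by (cases "t = Suc i") auto
qed auto

text \<open>Meeting at different indices would make a prefix of the pattern order isomorphic to a
  later factor, against \<open>swap_pattern_no_overlap\<close>. Index 0 is left out because a prefix
  of length 1 matches anything.\<close>

lemma position_unique:
  assumes "v \<in> S" "w \<in> S" "v ! i = w ! j" "1 \<le> i" "1 \<le> j" "i < m + 9" "j < m + 9"
    "i \<in> {m + 5, m + 6, m + 8}"
  shows "i = j"
proof (rule ccontr)
  \<comment> \<open>The critical index may end the prefix or the factor, so that
    \<open>i < j\<close> and \<open>j < i\<close> become instances of one claim.\<close>
  have key: False if "v \<in> S" "w \<in> S" "v ! i = w ! (s + i)" "1 \<le> s" "1 \<le> i" "s + i < m + 9"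
    and bad: "i \<in> {m + 5, m + 6, m + 8} \<or> s + i \<in> {m + 5, m + 6, m + 8}" for v w i s
  proof -
    have eq: "v ! t = w ! (s + t)" if "t \<le> i" for t
      using paths_agree_above that \<open>v \<in> S\<close> \<open>w \<in> S\<close> \<open>v ! i = w ! (s + i)\<close> \<open>s + i < m + 9\<close>
      by blast
    have "\<pi> ! t < \<pi> ! t' \<longleftrightarrow> \<pi> ! (s + t) < \<pi> ! (s + t')" if "t \<le> i" "t' \<le> i" for t t'
    proof -
      have "\<pi> ! t < \<pi> ! t' \<longleftrightarrow> v ! t < v ! t'"
        using marked_path(4)[OF \<open>v \<in> S\<close>, of t t'] that \<open>s + i < m + 9\<close> by simp
      also have "\<dots> \<longleftrightarrow> w ! (s + t) < w ! (s + t')" using eq that by simp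
      also have "\<dots> \<longleftrightarrow> \<pi> ! (s + t) < \<pi> ! (s + t')"
        using marked_path(4)[OF \<open>w \<in> S\<close>, of "s + t" "s + t'"] that \<open>s + i < m + 9\<close> by simp
      finally show ?thesis .
    qed
    from swap_pattern_no_overlap[OF big \<open>1 \<le> s\<close> \<open>1 \<le> i\<close> \<open>s + i < m + 9\<close> this] bad
    show False by blast
  qed
  assume "i \<noteq> j"
  then consider "i < j" | "j < i" by linarith
  then show False
  proof cases
    case 1
    define s where "s = j - i"
    have "j = s + i" "1 \<le> s" using 1 by (simp_all add: s_def)
    then show False using key[OF assms(1,2), of i s] assms(3-) by blast
  next
    case 2
    define s where "s = i - j"
    have "i = s + j" "1 \<le> s" using 2 by (simp_all add: s_def)
    then show False using key[OF assms(2,1), of j s] assms(3-) by metis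
  qed
qed

lemma paths_agree:
  assumes "v \<in> S" "w \<in> S" "v ! i = w ! i" "i < m + 9" "t \<le> i"
  shows "v ! t = w ! t"
  using paths_agree_above[OF assms(1,2), of i 0 t] assms(3-5) by simp

lemma bottoms_in_range: "bottoms m S a \<subseteq> {1..n}"
  using nth_in_range by (auto simp: bottoms_def)

lemma finite_bottoms: "finite (bottoms m S a)"
  using bottoms_in_range finite_subset by blast

lemma bot_in_bottoms: "v \<in> S \<Longrightarrow> bot_vertex v \<in> bottoms m S (top_vertex v)"
  by (auto simp: bottoms_def)

lemma mate_in_bottoms: "v \<in> S \<Longrightarrow> mate (top_vertex v) \<in> bottoms m S (top_vertex v)"
  using pick_in[OF finite_bottoms] bot_in_bottoms by blast

lemma mate_path:
  assumes "v \<in> S"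
  obtains w where "w \<in> S" "top_vertex w = top_vertex v" "bot_vertex w = mate (top_vertex v)"
  using mate_in_bottoms[OF assms] by (auto simp: bottoms_def)

text \<open>Climbing three edges from a bottom vertex determines its top, hence distinct tops have
  disjoint sets of bottoms.\<close>

lemma bottoms_top_unique:
  assumes "v \<in> S" "bot_vertex v \<in> bottoms m S a"
  shows "a = top_vertex v"
proof -
  from assms obtain w where "w \<in> S" "bot_vertex w = bot_vertex v" "top_vertex w = a"
    by (auto simp: bottoms_def)
  then show ?thesis using paths_agree[of w v "m + 8" "m + 5"] assms(1) by simp
qed

section \<open>The exchange as an involution on vertices\<close>

lemma swap_rel_iff:
  "(a, b) \<in> swap_rel m up S \<longleftrightarrow> (\<exists>v\<in>S. a = top_vertex v \<and> b = mate a)"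
  by (auto simp: swap_rel_def)

text \<open>A common vertex would sit at index \<open>m + 8\<close> of one marked path and at index
  \<open>m + 5\<close> of another.\<close>

lemma mate_neq_top:
  assumes "v \<in> S" "w \<in> S"
  shows "mate (top_vertex v) \<noteq> top_vertex w"
proof
  assume eq: "mate (top_vertex v) = top_vertex w"
  obtain u where "u \<in> S" "bot_vertex u = mate (top_vertex v)"
    using mate_path[OF assms(1)] by blast
  then show False using position_unique[OF assms(2), of u "m + 5" "m + 8"] eq by simp
qed

lemma mate_inj:
  assumes "v \<in> S" "w \<in> S" "mate (top_vertex v) = mate (top_vertex w)"
  shows "top_vertex v = top_vertex w"
proof -
  obtain v' where v': "v' \<in> S" "top_vertex v' = top_vertex v" "bot_vertex v' = mate (top_vertex v)"
    using mate_path[OF assms(1)] .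
  have "bot_vertex v' \<in> bottoms m S (top_vertex w)"
    using v' assms(3) mate_in_bottoms[OF assms(2)] by simp
  then show ?thesis using bottoms_top_unique v' by metis
qed

lemma theta_top: "v \<in> S \<Longrightarrow> \<theta> (top_vertex v) = mate (top_vertex v)"
proof -
  assume v: "v \<in> S"
  have "(THE b. (top_vertex v, b) \<in> swap_rel m up S \<union> (swap_rel m up S)\<inverse>) = mate (top_vertex v)"
    by (rule the_equality) (use v mate_neq_top in \<open>force simp: swap_rel_iff\<close>)+
  then show ?thesis using v by (auto simp: swap_map_def swap_rel_iff Domain_iff)
qed

lemma theta_mate: "v \<in> S \<Longrightarrow> \<theta> (mate (top_vertex v)) = top_vertex v"
proof -
  assume v: "v \<in> S"
  have "(THE b. (mate (top_vertex v), b) \<in> swap_rel m up S \<union> (swap_rel m up S)\<inverse>) = top_vertex v"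
  proof (rule the_equality)
    show "(mate (top_vertex v), top_vertex v) \<in> swap_rel m up S \<union> (swap_rel m up S)\<inverse>"
      using v by (auto simp: swap_rel_iff)
    show "b = top_vertex v"
      if "(mate (top_vertex v), b) \<in> swap_rel m up S \<union> (swap_rel m up S)\<inverse>" for b
      using that v mate_neq_top mate_inj by (auto simp: swap_rel_iff)
  qed
  then show ?thesis using v by (auto simp: swap_map_def swap_rel_iff Domain_iff)
qed

lemma theta_other:
  "(\<And>v. v \<in> S \<Longrightarrow> w \<noteq> top_vertex v \<and> w \<noteq> mate (top_vertex v)) \<Longrightarrow> \<theta> w = w"
  by (auto simp: swap_map_def swap_rel_iff Domain_iff)

lemma theta_cases:
  obtains v where "v \<in> S" "w = top_vertex v" "\<theta> w = mate (top_vertex v)"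
  | v where "v \<in> S" "w = mate (top_vertex v)" "\<theta> w = top_vertex v"
  | "\<theta> w = w" "\<And>v. v \<in> S \<Longrightarrow> w \<noteq> top_vertex v \<and> w \<noteq> mate (top_vertex v)"
  using theta_top theta_mate theta_other by metis

lemma theta_theta [simp]: "\<theta> (\<theta> w) = w"
  by (cases rule: theta_cases[of w]) (simp_all add: theta_top theta_mate)

text \<open>Both members of an exchanged pair occur at a critical index of some marked path, so
  \<open>position_unique\<close> bars them from every other index except 0.\<close>

lemma theta_fixed:
  assumes "v \<in> S" "1 \<le> t" "t < m + 9" "t \<noteq> m + 5" "t \<noteq> m + 8"
  shows "\<theta> (v ! t) = v ! t"
proof (rule theta_other)
  fix w assume w: "w \<in> S"
  obtain u where "u \<in> S" "bot_vertex u = mate (top_vertex w)" using mate_path[OF w] by blast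
  then show "v ! t \<noteq> top_vertex w \<and> v ! t \<noteq> mate (top_vertex w)"
    using position_unique[OF w assms(1), of "m + 5" t]
      position_unique[OF _ assms(1), of u "m + 8" t] assms by auto
qed

lemma theta_bot:
  assumes "v \<in> S"
  shows "\<theta> (bot_vertex v) =
    (if bot_vertex v = mate (top_vertex v) then top_vertex v else bot_vertex v)"
proof (cases "bot_vertex v = mate (top_vertex v)")
  case True
  then show ?thesis using theta_mate[OF assms] by simp
next
  case False
  have "\<theta> (bot_vertex v) = bot_vertex v"
  proof (rule theta_other)
    fix w assume w: "w \<in> S"
    have "bot_vertex v \<noteq> mate (top_vertex w)"
      using bottoms_top_unique[OF assms, of "top_vertex w"] mate_in_bottoms[OF w] False by metis
    then show "bot_vertex v \<noteq> top_vertex w \<and> bot_vertex v \<noteq> mate (top_vertex w)"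
      using position_unique[OF w assms, of "m + 5" "m + 8"] by auto
  qed
  then show ?thesis using False by simp
qed

lemma theta_in_range: "w \<in> {1..n} \<Longrightarrow> \<theta> w \<in> {1..n}"
proof (cases rule: theta_cases[of w])
  case (1 v)
  then show ?thesis using mate_in_bottoms bottoms_in_range by fastforce
next
  case (2 v)
  then show ?thesis using nth_in_range[of v "m + 5"] by simp
qed auto

lemma theta_outside: "w \<notin> {1..n} \<Longrightarrow> \<theta> w = w"
  using theta_in_range[of "\<theta> w"] nth_in_range[of _ "m + 5"] mate_in_bottoms bottoms_in_range
  by (cases rule: theta_cases[of w]) fastforce+

section \<open>Marked paths after the exchange\<close>

lemma not_below_top:
  assumes "v \<in> S" "1 \<le> t" "t < m + 9" "t \<noteq> m + 6"
  shows "v ! t \<notin> (\<lambda>v. v ! (m + 6)) ` S"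
proof
  assume "v ! t \<in> (\<lambda>v. v ! (m + 6)) ` S"
  then obtain w where "w \<in> S" "w ! (m + 6) = v ! t" by auto
  then show False using position_unique[OF _ assms(1), of w "m + 6" t] assms by simp
qed

lemma length_path': "v \<in> S \<Longrightarrow> length (path' v) = m + 9"
  by (simp add: swap_path_def marked_path(1))

lemma path'_nth:
  assumes "v \<in> S" "t < m + 9"
  shows "path' v ! t = (if t = m + 5 then mate (top_vertex v)
    else if t = m + 8 then \<theta> (bot_vertex v) else v ! t)"
  using assms marked_path(1)[OF assms(1)] by (simp add: swap_path_def nth_list_update theta_top)

lemma par'_path':
  assumes v: "v \<in> S" and t: "Suc t < m + 9"
  shows "par' (path' v ! Suc t) = Some (path' v ! t)"
proof -
  note par_v = marked_path(3)[OF v t]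
  \<comment> \<open>Only the edges into the top, out of the top and into the bottom have an endpoint
    that \<open>path'\<close> changes.\<close>
  consider "Suc t = m + 5" | "Suc t = m + 6" | "Suc t = m + 8"
    | "Suc t \<notin> {m + 5, m + 6, m + 8}" by blast
  then show ?thesis
  proof cases
    case 1
    obtain w where "w \<in> S" "bot_vertex w = mate (top_vertex v)" using mate_path[OF v] by blast
    then have "mate (top_vertex v) \<notin> (\<lambda>v. v ! (m + 6)) ` S"
      using not_below_top[of w "m + 8"] by simp
    moreover have "t = m + 4" using 1 by simp
    ultimately show ?thesis using par_v v 1
      by (simp add: path'_nth swap_par_def theta_mate)
  next
    case 2
    then have t5: "t = m + 5" by simp
    show ?thesis using par_v v unfolding 2 unfolding t5
      by (simp add: path'_nth swap_par_def theta_top)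
  next
    case 3
    have "\<theta> (bot_vertex v) \<notin> (\<lambda>v. v ! (m + 6)) ` S"
      using not_below_top[OF v, of "m + 5"] not_below_top[OF v, of "m + 8"] theta_bot[OF v] by simp
    moreover have "t = m + 7" using 3 by simp
    ultimately show ?thesis using par_v v 3 by (simp add: path'_nth swap_par_def)
  next
    case 4
    then have "v ! Suc t \<notin> (\<lambda>v. v ! (m + 6)) ` S" "\<theta> (v ! Suc t) = v ! Suc t"
      using not_below_top[OF v, of "Suc t"] theta_fixed[OF v, of "Suc t"] t by auto
    moreover have "t \<noteq> m + 5" "t \<noteq> m + 8" using 4 t by auto
    ultimately show ?thesis using par_v v 4 t by (simp add: path'_nth swap_par_def)
  qed
qed

text \<open>All marked paths through one top share their vertices at indices 1 and 2, in the roles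
  of 4 and 7. The values 5 and 6 lie between these, so the same two labels enclose the top and all
  its bottoms.\<close>

lemma star_bounds:
  assumes v: "v \<in> S" and b: "b \<in> bottoms m S (top_vertex v)"
  shows "v ! 1 < b" "b < v ! 2" "v ! 1 < top_vertex v" "top_vertex v < v ! 2"
    "top_vertex v < b \<longleftrightarrow> up" "b < top_vertex v \<longleftrightarrow> \<not> up"
proof -
  from b obtain w where w: "w \<in> S" "top_vertex w = top_vertex v" "b = bot_vertex w"
    by (auto simp: bottoms_def)
  have eq: "w ! 1 = v ! 1" "w ! 2 = v ! 2"
    using paths_agree[OF w(1) v w(2)] by simp_all
  note nth = swap_pattern_nth[where \<sigma> = \<sigma> and up = up]
  show "v ! 1 < b" "b < v ! 2" "v ! 1 < top_vertex v" "top_vertex v < v ! 2"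
    "top_vertex v < b \<longleftrightarrow> up" "b < top_vertex v \<longleftrightarrow> \<not> up"
    unfolding w(3) eq[symmetric] w(2)[symmetric]
    using marked_path(4)[OF w(1), of 1 "m + 8"] marked_path(4)[OF w(1), of "m + 8" 2]
      marked_path(4)[OF w(1), of 1 "m + 5"] marked_path(4)[OF w(1), of "m + 5" 2]
      marked_path(4)[OF w(1), of "m + 5" "m + 8"] marked_path(4)[OF w(1), of "m + 8" "m + 5"]
    by (simp_all add: nth)
qed

lemma pattern_outside_gap:
  assumes "i < m + 9" "i \<noteq> m + 5" "i \<noteq> m + 8"
  shows "swap_pattern (\<not> up) \<sigma> ! i = \<pi> ! i" "\<pi> ! i \<le> 4 \<or> 7 \<le> \<pi> ! i"
proof -
  have "10 \<le> \<sigma> ! (i - 3)" if "3 \<le> i" "i < m + 3"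
    using big(1) that nth_mem[of "i - 3" \<sigma>] by force
  with assms show "swap_pattern (\<not> up) \<sigma> ! i = \<pi> ! i" "\<pi> ! i \<le> 4 \<or> 7 \<le> \<pi> ! i"
    by - (rule index_cases[of i m]; simp add: swap_pattern_nth)+
qed

text \<open>The new entries at \<open>m + 5\<close> and \<open>m + 8\<close> stay between
  \<open>v ! 1\<close> and \<open>v ! 2\<close>, and no other entry lies strictly between these.
  Hence only the mutual order of the two is reversed.\<close>

lemma path'_order:
  assumes v: "v \<in> S" and ij: "i < m + 9" "j < m + 9"
  shows "path' v ! i < path' v ! j \<longleftrightarrow>
    swap_pattern (\<not> up) \<sigma> ! i < swap_pattern (\<not> up) \<sigma> ! j"
proof -
  let ?\<rho> = "swap_pattern (\<not> up) \<sigma>"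
  define A B where "A = path' v ! (m + 5)" and "B = path' v ! (m + 8)"
  have A: "A = mate (top_vertex v)" and B: "B = \<theta> (bot_vertex v)"
    using v by (simp_all add: A_def B_def path'_nth)
  note mate = mate_in_bottoms[OF v] and bot = bot_in_bottoms[OF v]
  have A_gap: "v ! 1 < A" "A < v ! 2" and B_gap: "v ! 1 < B" "B < v ! 2"
    using star_bounds[OF v mate] star_bounds[OF v bot] theta_bot[OF v] by (auto simp: A B)
  \<comment> \<open>If the bottom is the mate, then \<open>B\<close> is the old top. Otherwise
    \<open>B\<close> is a bottom different from the extremum \<open>A\<close>.\<close>
  have BA: "B < A \<longleftrightarrow> up" "A < B \<longleftrightarrow> \<not> up" "A \<noteq> B"
    using star_bounds[OF v mate] theta_bot[OF v] less_pick_iff[OF finite_bottoms bot, of up]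
    by (auto simp: A B split: if_splits)
  have special: "v ! 1 < path' v ! t \<and> path' v ! t < v ! 2 \<and> 4 < ?\<rho> ! t \<and> ?\<rho> ! t < 7"
    if "t \<in> {m + 5, m + 8}" for t
    using that A_gap B_gap by (auto simp: A_def B_def swap_pattern_nth)
  have ordinary: "path' v ! t = v ! t \<and> ?\<rho> ! t = \<pi> ! t \<and>
      (v ! t \<le> v ! 1 \<and> \<pi> ! t \<le> 4 \<or> v ! 2 \<le> v ! t \<and> 7 \<le> \<pi> ! t)"
    if "t < m + 9" "t \<notin> {m + 5, m + 8}" for t
    using that pattern_outside_gap[of t] v marked_path(4)[OF v, of 1 t] marked_path(4)[OF v, of t 2]
    by (auto simp: path'_nth swap_pattern_nth)
  show ?thesis
  proof (cases "i \<in> {m + 5, m + 8}"; cases "j \<in> {m + 5, m + 8}")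
    assume "i \<in> {m + 5, m + 8}" "j \<in> {m + 5, m + 8}"
    then show ?thesis using BA by (auto simp: A_def B_def swap_pattern_nth)
  next
    assume "i \<in> {m + 5, m + 8}" "j \<notin> {m + 5, m + 8}"
    then show ?thesis using special[of i] ordinary[of j] ij by linarith
  next
    assume "i \<notin> {m + 5, m + 8}" "j \<in> {m + 5, m + 8}"
    then show ?thesis using special[of j] ordinary[of i] ij by linarith
  next
    assume "i \<notin> {m + 5, m + 8}" "j \<notin> {m + 5, m + 8}"
    then show ?thesis using ordinary[of i] ordinary[of j] ij marked_path(4)[OF v, of i j] by simp
  qed
qed

lemma path'_occurrence:
  assumes v: "v \<in> S"
  shows "path' v \<in> occurrences n par' (swap_pattern (\<not> up) \<sigma>)"
proof -
  have "set (path' v) \<subseteq> {1..n}"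
    unfolding swap_path_def
    using marked_path(2)[OF v] theta_in_range nth_in_range[OF v]
    by (intro set_update_subsetI) simp_all
  moreover have "consec_instance par' (swap_pattern (\<not> up) \<sigma>) (path' v)"
    using length_path'[OF v] par'_path'[OF v] path'_order[OF v] by (auto simp: consec_instance_def)
  ultimately show ?thesis by (simp add: occurrences_def)
qed

section \<open>Acyclicity of the new parent map\<close>

text \<open>Prepares the induction in \<open>par'_acyclic\<close>: the mate moves up to a parent
  that was already a strict ancestor of both the top and the mate.\<close>

lemma par'_bot_ancestor:
  assumes "v \<in> S"
  shows "par' (mate (top_vertex v)) = Some (v ! (m + 4))" "(v ! (m + 4), top_vertex v) \<in> parent_rel par"
    "(v ! (m + 4), mate (top_vertex v)) \<in> (parent_rel par)\<^sup>+"
proof -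
  show "par' (mate (top_vertex v)) = Some (v ! (m + 4))"
    using par'_path'[OF assms, of "m + 4"] assms by (simp add: path'_nth)
  show edge: "(v ! (m + 4), top_vertex v) \<in> parent_rel par"
    using marked_edge[OF assms, of "m + 5" "m + 4"]
    by (simp add: parent_rel_def)
  obtain w where w: "w \<in> S" "top_vertex w = top_vertex v" "bot_vertex w = mate (top_vertex v)"
    using mate_path[OF assms] .
  have "(top_vertex v, w ! (m + 6)) \<in> parent_rel par"
    "(w ! (m + 6), w ! (m + 7)) \<in> parent_rel par"
    "(w ! (m + 7), mate (top_vertex v)) \<in> parent_rel par"
    using w marked_edge[OF w(1), of "m + 6" "m + 5"] marked_edge[OF w(1), of "m + 7" "m + 6"]
      marked_edge[OF w(1), of "m + 8" "m + 7"] by (simp_all add: parent_rel_def)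
  with edge show "(v ! (m + 4), mate (top_vertex v)) \<in> (parent_rel par)\<^sup>+"
    by (rule trancl_into_trancl[OF trancl_into_trancl[OF trancl_into_trancl[OF r_into_trancl]]])
qed

lemma wf_parent_rel: "wf (parent_rel par)"
proof (rule finite_acyclic_wf)
  have "parent_rel par \<subseteq> {1..n} \<times> {1..n}"
  proof (rule subrelI)
    fix p v assume "(p, v) \<in> parent_rel par"
    then have "par v = Some p" by (simp add: parent_rel_def)
    then show "(p, v) \<in> {1..n} \<times> {1..n}"
      using forestsD(1)[OF forest, of v] forestsD(2)[OF forest, of v p] by (metis mem_Sigma_iff option.distinct(1))
  qed
  then show "finite (parent_rel par)" by (rule finite_subset) simp
qed (rule forestsD(3)[OF forest])

text \<open>Induction along the old ancestor relation shows that every vertex is accessible for the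
  new one: climbing the new forest from \<open>w\<close> reaches an old strict ancestor of
  \<open>w\<close> after boundedly many steps.\<close>

lemma par'_acyclic: "acyclic (parent_rel par')"
proof -
  let ?acc = "Wellfounded.acc (parent_rel par')"
  have acc_parent: "w \<in> ?acc" if "\<And>p. par' w = Some p \<Longrightarrow> p \<in> ?acc" for w
    by (rule accI) (use that in \<open>simp add: parent_rel_def\<close>)
  have "w \<in> ?acc" for w
  proof (induction w rule: wf_induct[OF wf_trancl[OF wf_parent_rel]])
    case (1 w)
    then have IH: "p \<in> ?acc" if "(p, w) \<in> (parent_rel par)\<^sup>+" for p
      using that by blast
    have mate_acc: "mate (top_vertex v) \<in> ?acc" if "v \<in> S" "(top_vertex v, w) \<in> (parent_rel par)\<^sup>*" for v
    proof -
      have "(v ! (m + 4), w) \<in> (parent_rel par)\<^sup>+"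
        using par'_bot_ancestor(2)[OF that(1)] that(2) by (rule rtrancl_into_trancl2)
      then show ?thesis
        using acc_parent[of "mate (top_vertex v)"] par'_bot_ancestor(1)[OF that(1)] IH by simp
    qed
    show "w \<in> ?acc"
    proof (cases "w \<in> (\<lambda>v. v ! (m + 6)) ` S")
      case True
      then obtain v where v: "v \<in> S" "w = v ! (m + 6)" by auto
      have "par w = Some (top_vertex v)"
        using marked_edge[OF v(1), of "m + 6" "m + 5"] v(2) by simp
      then have "par' w = Some (mate (top_vertex v))" "(top_vertex v, w) \<in> parent_rel par"
        using v True by (simp_all add: swap_par_def theta_top parent_rel_def)
      moreover from this have "mate (top_vertex v) \<in> ?acc"
        using mate_acc[OF v(1)] by blast
      ultimately show ?thesis using acc_parent[of w] by simp
    next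
      case False
      show ?thesis
      proof (cases rule: theta_cases[of w])
        case (1 v)
        \<comment> \<open>The new parent of an old top is one of its old descendants, which the
          induction hypothesis does not cover. The climb continues along the exchanged path
          \<open>path' u\<close> up to the mate, which is accessible by
          \<open>mate_acc\<close>.\<close>
        obtain u where u: "u \<in> S" "top_vertex u = w" "bot_vertex u = mate w"
          using mate_path[OF 1(1)] unfolding 1(2)[symmetric] .
        have "par' (path' u ! j) = Some (path' u ! i)" if "j = Suc i" "j < m + 9" for i j
          using par'_path'[OF u(1), of i] that by simp
        from this[of "m + 6" "m + 5"] this[of "m + 7" "m + 6"] this[of "m + 8" "m + 7"]
        have "par' w = Some (u ! (m + 7))" "par' (u ! (m + 7)) = Some (u ! (m + 6))"
          "par' (u ! (m + 6)) = Some (mate w)"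
          using u theta_bot[OF u(1)] by (simp_all add: path'_nth)
        moreover have "mate w \<in> ?acc" using mate_acc[OF 1(1)] 1(2) by simp
        ultimately show ?thesis
          using acc_parent[of w] acc_parent[of "u ! (m + 7)"] acc_parent[of "u ! (m + 6)"] by simp
      next
        case (2 v)
        then show ?thesis using par'_bot_ancestor(1,3)[OF 2(1)] IH acc_parent[of w] by simp
      next
        case 3
        then have "par' w = par w" using False by (simp add: swap_par_def)
        moreover have "p \<in> ?acc" if "par w = Some p" for p
          using that IH[of p] by (simp add: parent_rel_def r_into_trancl')
        ultimately show ?thesis using acc_parent[of w] by simp
      qed
    qed
  qed
  then show ?thesis by (intro wf_acyclic acc_wfI) simp
qed

lemma par'_forest: "par' \<in> forests n"
proof -
  have "par' w = None" if "w \<notin> {1..n}" for w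
    using forestsD(1)[OF forest that] theta_outside[OF that] by (simp add: swap_par_def)
  moreover have "p \<in> {1..n}" if "par' w = Some p" for w p
    using that forestsD(2)[OF forest] theta_in_range unfolding swap_par_def by (force split: if_splits)
  ultimately show ?thesis using par'_acyclic unfolding forests_def by blast
qed

section \<open>Inverting the exchange\<close>

text \<open>The bottoms of the new top are the old top and some of the old bottoms. The old top lies
  on one side of all of these, so the opposite extremum recovers it.\<close>

lemma bottoms_swapped:
  assumes "v \<in> S"
  shows "pick (\<not> up) (bottoms m (path' ` S) (mate (top_vertex v))) = top_vertex v"
proof (rule ccontr)
  let ?X = "bottoms m (path' ` S) (mate (top_vertex v))"
  assume ne: "\<not> ?thesis"
  have X: "b = top_vertex v \<or> b \<in> bottoms m S (top_vertex v)" if "b \<in> ?X" for b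
  proof -
    from that obtain w where w: "w \<in> S" "path' w ! (m + 5) = mate (top_vertex v)"
      "b = path' w ! (m + 8)" by (auto simp: bottoms_def)
    then have "top_vertex w = top_vertex v" using mate_inj[of w v] assms by (simp add: path'_nth)
    then show ?thesis using w theta_bot[OF w(1)] bot_in_bottoms[OF w(1)] by (simp add: path'_nth)
  qed
  obtain w where w: "w \<in> S" "top_vertex w = top_vertex v" "bot_vertex w = mate (top_vertex v)"
    using mate_path[OF assms] .
  then have "path' w ! (m + 5) = mate (top_vertex v)" "path' w ! (m + 8) = top_vertex v"
    using theta_mate[OF assms] by (simp_all add: path'_nth)
  then have top: "top_vertex v \<in> ?X" using w(1) unfolding bottoms_def by force
  have fin: "finite ?X"
    by (rule finite_subset[of _ "insert (top_vertex v) (bottoms m S (top_vertex v))"])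
      (use X finite_bottoms in auto)
  have "pick (\<not> up) ?X \<in> bottoms m S (top_vertex v)"
    using X[OF pick_in[OF fin]] top ne by blast
  then show False
    using star_bounds(5)[OF assms] less_pick_iff[OF fin top, of "\<not> up"] ne by metis
qed

text \<open>The relation turns into its converse, and \<open>swap_map\<close> depends only on the
  symmetric closure.\<close>

lemma swap_map_swapped: "swap_map m (\<not> up) (path' ` S) = \<theta>"
proof -
  have "swap_rel m (\<not> up) (path' ` S) =
      (\<lambda>v. (top_vertex v, pick (\<not> up) (bottoms m (path' ` S) (top_vertex v)))) ` path' ` S"
    unfolding swap_rel_def by blast
  also have "\<dots> = (\<lambda>v. (mate (top_vertex v), top_vertex v)) ` S"
    unfolding image_image by (intro image_cong refl) (simp add: path'_nth bottoms_swapped)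
  also have "\<dots> = (swap_rel m up S)\<inverse>"
    by (auto simp: swap_rel_def)
  finally show ?thesis by (simp add: swap_map_def fun_eq_iff Un_commute)
qed

lemma swap_path_swapped: "v \<in> S \<Longrightarrow> swap_path m (\<not> up) (path' ` S) (path' v) = v"
proof -
  assume v: "v \<in> S"
  have "swap_path m (\<not> up) (path' ` S) (path' v) =
      (path' v)[m + 5 := \<theta> (path' v ! (m + 5)), m + 8 := \<theta> (path' v ! (m + 8))]"
    by (simp only: swap_path_def[of m "\<not> up"] swap_map_swapped)
  also have "\<dots> = v"
    using v marked_path(1)[OF v] length_path'[OF v]
    by (intro nth_equalityI) (auto simp: path'_nth nth_list_update theta_mate)
  finally show ?thesis .
qed

lemma swap_path_image_swapped: "swap_path m (\<not> up) (path' ` S) ` path' ` S = S"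
  using swap_path_swapped by force

lemma card_path'_image: "card (path' ` S) = card S"
  by (rule card_image) (metis inj_on_inverseI swap_path_swapped)

text \<open>The vertices at index \<open>m + 6\<close> are untouched and the involution preserves
  their complement. Both passes therefore take the same branch of \<open>swap_par\<close>, where the
  two applications of the involution cancel.\<close>

lemma swap_par_swapped: "swap_par m (\<not> up) (path' ` S) par' = par"
proof
  fix w
  have D: "(\<lambda>v. v ! (m + 6)) ` path' ` S = (\<lambda>v. v ! (m + 6)) ` S"
    by (auto simp: path'_nth image_image)
  show "swap_par m (\<not> up) (path' ` S) par' w = par w"
  proof (cases "w \<in> (\<lambda>v. v ! (m + 6)) ` S")
    case True
    then show ?thesis
      unfolding swap_par_def D swap_map_swapped
      by (simp add: option.map_comp comp_def option.map_ident)
  next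
    case False
    have "\<theta> w \<notin> (\<lambda>v. v ! (m + 6)) ` S"
    proof (cases rule: theta_cases[of w])
      case (1 v)
      obtain u where "u \<in> S" "bot_vertex u = mate (top_vertex v)" using mate_path[OF 1(1)] by blast
      then show ?thesis using not_below_top[of u "m + 8"] 1 by simp
    next
      case (2 v)
      then show ?thesis using not_below_top[of v "m + 5"] by simp
    qed (use False in simp)
    then show ?thesis using False
      unfolding swap_par_def D swap_map_swapped by simp
  qed
qed

end

section \<open>Inclusion-exclusion over marked instances\<close>

definition marked_forests :: "nat \<Rightarrow> nat list \<Rightarrow> ((nat \<Rightarrow> nat option) \<times> nat list set) set" where
  "marked_forests n \<pi> = (SIGMA par : forests n. Pow (occurrences n par \<pi>))"

lemma finite_forests: "finite (forests n)"
proof (rule finite_subset)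
  show "forests n \<subseteq> {f. \<forall>x. (x \<in> {1..n} \<longrightarrow> f x \<in> insert None (Some ` {1..n})) \<and>
    (x \<notin> {1..n} \<longrightarrow> f x = None)}"
  proof (intro subsetI CollectI allI conjI impI)
    fix f x assume f: "f \<in> forests n"
    show "f x \<in> insert None (Some ` {1..n})"
      using forestsD(2)[OF f, of x] by (cases "f x") blast+
    show "f x = None" if "x \<notin> {1..n}" using forestsD(1)[OF f that] .
  qed
qed (rule finite_set_of_finite_funs; simp)

lemma finite_occurrences: "finite (occurrences n par \<pi>)"
  by (rule finite_subset[OF _ finite_lists_length_eq[of "{1..n}" "length \<pi>"]])
    (auto simp: occurrences_def consec_instance_def)

text \<open>This is the expansion of the product of \<open>1 - 1\<close> over
  \<open>A\<close>.\<close>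

lemma sum_alternating_Pow:
  assumes "finite A"
  shows "(\<Sum>X\<in>Pow A. (- 1 :: int) ^ card X) = (if A = {} then 1 else 0)"
  using prod_diff_conv_sum[OF assms, of "\<lambda>_. 1 :: int" "\<lambda>_. 1"] assms by (simp add: power_0_left)

lemma avoid_count_inclusion_exclusion:
  "int (avoid_count n \<pi>) = (\<Sum>(par, S)\<in>marked_forests n \<pi>. (- 1) ^ card S)"
proof -
  have contains: "contains_pattern n par \<pi> \<longleftrightarrow> occurrences n par \<pi> \<noteq> {}" for par
    by (auto simp: contains_pattern_def occurrences_def)
  have "int (avoid_count n \<pi>) = (\<Sum>par\<in>forests n. if contains_pattern n par \<pi> then 0 else 1)"
    using finite_forests by (simp add: avoid_count_def sum.If_cases Int_def)
  also have "\<dots> = (\<Sum>par\<in>forests n. \<Sum>S\<in>Pow (occurrences n par \<pi>). (- 1) ^ card S)"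
    by (intro sum.cong refl) (simp add: sum_alternating_Pow finite_occurrences contains)
  also have "\<dots> = (\<Sum>(par, S)\<in>marked_forests n \<pi>. (- 1) ^ card S)"
    unfolding marked_forests_def
    by (rule sum.Sigma) (simp_all add: finite_forests finite_occurrences)
  finally show ?thesis .
qed

text \<open>The exchange is a bijection between the marked forests of the two patterns. It preserves
  the number of marks and hence the sign of each term.\<close>

lemma swap_pattern_equiv:
  assumes "set \<sigma> \<subseteq> {10..}" "\<sigma> \<noteq> []"
  shows "c_forest_wilf_equiv (swap_pattern True \<sigma>) (swap_pattern False \<sigma>)"
  unfolding c_forest_wilf_equiv_def
proof
  fix n
  let ?swap = "\<lambda>up (par, S). (swap_par (length \<sigma>) up S par, swap_path (length \<sigma>) up S ` S)"
  let ?M = "\<lambda>up. marked_forests n (swap_pattern up \<sigma>)"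
  have swap: "?swap up x \<in> ?M (\<not> up)" "?swap (\<not> up) (?swap up x) = x"
    "card (snd (?swap up x)) = card (snd x)" if "x \<in> ?M up" for up x
  proof -
    obtain par S where x: "x = (par, S)" by (cases x)
    from that assms interpret marked_forest n up \<sigma> par S
      by unfold_locales (auto simp: marked_forests_def x)
    show "?swap up x \<in> ?M (\<not> up)"
      using par'_forest path'_occurrence by (auto simp: marked_forests_def x)
    show "?swap (\<not> up) (?swap up x) = x"
      by (simp add: x swap_par_swapped swap_path_image_swapped)
    show "card (snd (?swap up x)) = card (snd x)"
      by (simp add: x card_path'_image)
  qed
  have "(\<Sum>x\<in>?M True. (- 1 :: int) ^ card (snd x)) = (\<Sum>x\<in>?M False. (- 1) ^ card (snd x))"
    by (rule sum.reindex_bij_witness[of _ "?swap False" "?swap True"])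
      (use swap[where up = True] swap[where up = False] in \<open>simp_all del: split_paired_All\<close>)
  then have "int (avoid_count n (swap_pattern True \<sigma>)) = int (avoid_count n (swap_pattern False \<sigma>))"
    unfolding avoid_count_inclusion_exclusion by (simp add: case_prod_beta')
  then show "avoid_count n (swap_pattern True \<sigma>) = avoid_count n (swap_pattern False \<sigma>)"
    by simp
qed

section \<open>Counting the patterns\<close>

lemma swap_pattern_in_patterns:
  assumes "9 \<le> n" "\<sigma> \<in> permutations_of_set {10..n}"
  shows "swap_pattern up \<sigma> \<in> patterns n"
proof -
  have "set \<sigma> = {10..n}" "distinct \<sigma>" using assms(2) by (auto simp: permutations_of_set_def)
  moreover have "length \<sigma> + 9 = n"
    using distinct_card[of \<sigma>] calculation assms(1) by simp
  moreover have "{1..n} = {1, 2, 3, 4, 5, 6, 7, 8, 9} \<union> {10..n}"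
    using assms(1) by auto
  ultimately show ?thesis
    unfolding patterns_def by (auto simp: swap_pattern_def)
qed

lemma card_nontrivially_equivalent:
  assumes "10 \<le> n"
  shows "fact (n - 9) \<le> card {\<pi> \<in> patterns n. \<exists>\<pi>' \<in> patterns n.
    \<pi>' \<noteq> \<pi> \<and> \<pi>' \<noteq> complement \<pi> \<and> c_forest_wilf_equiv \<pi> \<pi>'}" (is "_ \<le> card ?E")
proof -
  let ?P = "permutations_of_set {10..n}"
  have "swap_pattern True \<sigma> \<in> ?E" if \<sigma>: "\<sigma> \<in> ?P" for \<sigma>
  proof -
    have set: "set \<sigma> = {10..n}" using \<sigma> by (rule permutations_of_setD)
    have "swap_pattern False \<sigma> \<noteq> swap_pattern True \<sigma>" by (simp add: swap_pattern_def)
    \<comment> \<open>The complement starts with the largest value instead of 1.\<close>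
    moreover have "swap_pattern False \<sigma> \<noteq> complement (swap_pattern True \<sigma>)"
      by (simp add: complement_def swap_pattern_def)
    moreover have "c_forest_wilf_equiv (swap_pattern True \<sigma>) (swap_pattern False \<sigma>)"
      using set assms by (intro swap_pattern_equiv) auto
    moreover have "swap_pattern up \<sigma> \<in> patterns n" for up
      using swap_pattern_in_patterns[OF _ \<sigma>] assms by simp
    ultimately show ?thesis by blast
  qed
  moreover have "inj_on (swap_pattern True) ?P" by (auto simp: inj_on_def swap_pattern_def)
  moreover have "finite ?E"
    by (rule finite_subset[OF _ finite_lists_length_eq[of "{1..n}" n]]) (auto simp: patterns_def)
  ultimately have "card ?P \<le> card ?E" by (intro card_inj_on_le[of "swap_pattern True"]) auto
  then show ?thesis by simp
qed

text \<open>With \<open>r\<close> the ninth root of \<open>c\<close>, the left side is the ninth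
  power of \<open>n * r ^ n\<close>, which tends to 0.\<close>

lemma eventually_power_times_exp_le_1:
  fixes c :: real
  assumes "0 < c" "c < 1"
  shows "\<forall>\<^sub>F n in sequentially. c ^ n * real n ^ 9 \<le> 1"
proof -
  define r where "r = root 9 c"
  have r: "0 < r" "r < 1" "r ^ 9 = c" using assms by (simp_all add: r_def)
  have "(\<lambda>n. real n * r ^ n) \<longlonglongrightarrow> 0" using r by (intro powser_times_n_limit_0) simp
  then have "\<forall>\<^sub>F n in sequentially. real n * r ^ n < 1" by (rule order_tendstoD) simp
  then show ?thesis
  proof eventually_elim
    case (elim n)
    have "c ^ n * real n ^ 9 = (real n * r ^ n) ^ 9"
      by (simp add: power_mult_distrib mult.commute flip: r(3) power_mult)
    also have "\<dots> \<le> 1" using elim r by (intro power_le_one) auto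
    finally show ?case .
  qed
qed

theorem theorem1p6:
  fixes c :: real
  assumes "0 < c" and "c < 1"
  shows "\<exists>n\<^sub>c :: nat. \<forall>n > n\<^sub>c.
           real (card {\<pi> \<in> patterns n. \<exists>\<pi>' \<in> patterns n.
                 \<pi>' \<noteq> \<pi> \<and> \<pi>' \<noteq> complement \<pi> \<and> c_forest_wilf_equiv \<pi> \<pi>'})
           \<ge> c ^ n * fact n"
proof -
  from eventually_power_times_exp_le_1[OF assms]
  obtain N where N: "\<And>n. n \<ge> N \<Longrightarrow> c ^ n * real n ^ 9 \<le> 1"
    unfolding eventually_sequentially by blast
  \<comment> \<open>The bound 9 ensures that the middle word, on the values \<open>{10..n}\<close>,
    is not empty.\<close>
  have "c ^ n * fact n \<le> real (card {\<pi> \<in> patterns n. \<exists>\<pi>' \<in> patterns n.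
      \<pi>' \<noteq> \<pi> \<and> \<pi>' \<noteq> complement \<pi> \<and> c_forest_wilf_equiv \<pi> \<pi>'})" (is "_ \<le> real (card ?E)")
    if "n > max N 9" for n
  proof -
    have "fact n = (fact n div fact (n - 9)) * (fact (n - 9) :: nat)"
      using fact_dvd[of "n - 9" n, where ?'a = nat] by simp
    \<comment> \<open>The quotient is a product of nine factors, each at most
      \<open>n\<close>.\<close>
    also have "\<dots> \<le> n ^ 9 * fact (n - 9)"
      using fact_div_fact_le_pow[of 9 n] that by (intro mult_right_mono) auto
    finally have "real (fact n) \<le> real (n ^ 9 * fact (n - 9))" by (rule of_nat_mono)
    then have "c ^ n * fact n \<le> (c ^ n * real n ^ 9) * fact (n - 9)"
      using assms by simp
    also have "\<dots> \<le> 1 * fact (n - 9)"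
      using N[of n] that by (intro mult_right_mono) auto
    also have "\<dots> = real (fact (n - 9))" by simp
    also have "\<dots> \<le> real (card ?E)"
      using card_nontrivially_equivalent[of n] that by (intro of_nat_mono) simp
    finally show ?thesis .
  qed
  then show ?thesis by blast
qed

end
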